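(* Let $G$ be a group with a $k$-ary semidirect-product decomposition $G = [A_k \cdots A_1]$, where $A_1,\ldots,A_k \leq G$, and let $S \subseteq G$ be atomic, i.e. $S \subseteq A_k \cup \cdots \cup A_1$. Then $\langle S \rangle$ has a similar semidirect-product decomposition $$\langle S \rangle = \left[(\mathcal{A}_k)_{\langle S \rangle} \cdots (\mathcal{A}_1)_{\langle S \rangle}\right],$$ where, for every $j \in \{1,\ldots,k\}$, $$(\mathcal{A}_j)_{\langle S \rangle} := \langle S \rangle \cap A_j = \langle (\mathcal{A}_j)_S^+ \rangle = \varphi_{A_j}(\langle S \rangle),$$ and the augmented generating set is $$(\mathcal{A}_j)_S^+ := \{\, b a b^{-1} \mid a \in S \cap A_j,\ b \in (\mathcal{A}_{j-1})_{\langle S \rangle} \cdots (\mathcal{A}_1)_{\langle S \rangle} \,\},$$ with, in particular, $(\mathcal{A}_1)_S^+ = S\cap A_1$ (the empty product being $\{e\}$).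
   Context: For subsets $A_1,\ldots,A_k$ of a group $G$, the product set is $A_k\cdots A_1=\{a_k\cdots a_1\mid a_i\in A_i\}$. For subgroups $A,B\leq G$, the notation $[AB]$ (inner semidirect product) means the product set $AB$ together with the requirements that $B\leq N_G(A)$ (the normalizer of $A$ in $G$) and $A\cap B=\{e\}$; $[AB]$ is then a subgroup. For subgroups $A_1,\ldots,A_k\leq G$, define recursively $[A_1]:=A_1$ and $[A_k\cdots A_1]:=[A_k[A_{k-1}\cdots A_1]]$; an equality $K=[A_k\cdots A_1]$ asserts that all the required normalizer and trivial-intersection conditions hold at each level of the recursion and that $K$ equals the resulting product set. If $G=[A_k\cdots A_1]$, every $g\in G$ can be written uniquely as $g=a_k\cdots a_1$ with $a_i\in A_i$; $\varphi_{A_j}:G\to A_j$ is the function $g\mapsto a_j$, and $\varphi_{A_j}(T)$ denotes the image of $T\subseteq G$. $\langle T\rangle$ denotes the subgroup generated by $T$. *)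

theory Defs
  imports "HOL-Algebra.Group_Action" "HOL-Algebra.Generated_Groups" "HOL-Library.FuncSet"
begin

text \<open>
  Families \<open>A\<^sub>1, \<dots>, A\<^sub>k\<close> are functions on \<open>nat\<close>, of which only the values at \<open>1, \<dots>, k\<close> matter.
  Products run in descending order of the index: \<open>desc_prod G a k\<close> is \<open>a\<^sub>k \<cdots> a\<^sub>1\<close>.
\<close>

primrec desc_prod :: "('a, 'b) monoid_scheme \<Rightarrow> (nat \<Rightarrow> 'a) \<Rightarrow> nat \<Rightarrow> 'a" where
  "desc_prod G a 0 = \<one>\<^bsub>G\<^esub>"
| "desc_prod G a (Suc n) = a (Suc n) \<otimes>\<^bsub>G\<^esub> desc_prod G a n"

definition product_set :: "('a, 'b) monoid_scheme \<Rightarrow> (nat \<Rightarrow> 'a set) \<Rightarrow> nat \<Rightarrow> 'a set" where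
  "product_set G A n = {desc_prod G a n | a. \<forall>i\<in>{1..n}. a i \<in> A i}"

text \<open>\<open>K = [AB]\<close>\<close>

definition is_semidirect ::
    "('a, 'b) monoid_scheme \<Rightarrow> 'a set \<Rightarrow> 'a set \<Rightarrow> 'a set \<Rightarrow> bool" where
  "is_semidirect G K A B \<longleftrightarrow>
     subgroup A G \<and> subgroup B G \<and> B \<subseteq> normalizer G A \<and> A \<inter> B = {\<one>\<^bsub>G\<^esub>} \<and> K = A <#>\<^bsub>G\<^esub> B"

text \<open>\<open>K = [A\<^sub>k \<cdots> A\<^sub>1]\<close>, which is only meaningful for \<open>k \<ge> 1\<close>.\<close>

fun semidirect_decomp ::
    "('a, 'b) monoid_scheme \<Rightarrow> 'a set \<Rightarrow> (nat \<Rightarrow> 'a set) \<Rightarrow> nat \<Rightarrow> bool" where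
  "semidirect_decomp G K A 0 \<longleftrightarrow> False"
| "semidirect_decomp G K A (Suc 0) \<longleftrightarrow> subgroup (A 1) G \<and> K = A 1"
| "semidirect_decomp G K A (Suc (Suc n)) \<longleftrightarrow>
     (\<exists>L. semidirect_decomp G L A (Suc n) \<and> is_semidirect G K (A (Suc (Suc n))) L)"

text \<open>
  \<open>\<phi>\<^bsub>A\<^sub>j\<^esub>\<close>: the factor \<open>a\<^sub>j\<close> in the unique factorisation \<open>g = a\<^sub>k \<cdots> a\<^sub>1\<close>. The extensional function
  space makes the tuple \<open>a\<close> unique as a function on \<open>nat\<close>.
\<close>

definition component ::
    "('a, 'b) monoid_scheme \<Rightarrow> (nat \<Rightarrow> 'a set) \<Rightarrow> nat \<Rightarrow> nat \<Rightarrow> 'a \<Rightarrow> 'a" where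
  "component G A k j g = (THE a. a \<in> (\<Pi>\<^sub>E i\<in>{1..k}. A i) \<and> g = desc_prod G a k) j"

definition trace :: "('a, 'b) monoid_scheme \<Rightarrow> (nat \<Rightarrow> 'a set) \<Rightarrow> 'a set \<Rightarrow> nat \<Rightarrow> 'a set" where
  "trace G A S j = generate G S \<inter> A j"

definition augmented_gens ::
    "('a, 'b) monoid_scheme \<Rightarrow> (nat \<Rightarrow> 'a set) \<Rightarrow> 'a set \<Rightarrow> nat \<Rightarrow> 'a set" where
  "augmented_gens G A S j =
     {b \<otimes>\<^bsub>G\<^esub> a \<otimes>\<^bsub>G\<^esub> inv\<^bsub>G\<^esub> b | a b. a \<in> S \<inter> A j \<and> b \<in> product_set G (trace G A S) (j - 1)}"

end

theory Submission
  imports Defs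
begin

text \<open>
  For a single semidirect product \<open>K = [AL]\<close> and \<open>T \<subseteq> A \<union> L\<close>, put \<open>M = \<langle>T \<inter> L\<rangle>\<close> and let \<open>N\<close> be
  generated by the \<open>M\<close>-conjugates of \<open>T \<inter> A\<close>. Then \<open>M\<close> normalizes \<open>N\<close>, so \<open>NM\<close> is a subgroup
  containing \<open>T\<close> and hence equals \<open>\<langle>T\<rangle>\<close>. As \<open>A \<inter> L\<close> is trivial, \<open>N \<subseteq> A\<close> and \<open>M \<subseteq> L\<close> force
  \<open>N = \<langle>T\<rangle> \<inter> A\<close> and \<open>M = \<langle>T\<rangle> \<inter> L\<close>. The general case is an induction on the number of factors,
  in which \<open>S\<close> is replaced by \<open>S \<inter> L\<close>. The components of elements of \<open>\<langle>S\<rangle>\<close> are then read off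
  from the uniqueness of factorisations.
\<close>

section \<open>Conjugation and normalizers\<close>

context group
begin

lemma conj_mult:
  assumes "b \<in> carrier G" "x \<in> carrier G" "y \<in> carrier G"
  shows "b \<otimes> (x \<otimes> y) \<otimes> inv b = (b \<otimes> x \<otimes> inv b) \<otimes> (b \<otimes> y \<otimes> inv b)"
proof -
  have "inv b \<otimes> (b \<otimes> (y \<otimes> inv b)) = y \<otimes> inv b"
    using assms by (subst inv_solve_left') auto
  then show ?thesis
    using assms by (simp add: m_assoc)
qed

lemma conj_conj:
  assumes "b \<in> carrier G" "c \<in> carrier G" "x \<in> carrier G"
  shows "c \<otimes> (b \<otimes> x \<otimes> inv b) \<otimes> inv c = (c \<otimes> b) \<otimes> x \<otimes> inv (c \<otimes> b)"
  using assms by (simp add: m_assoc inv_mult_group)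

lemma conj_inv:
  assumes "b \<in> carrier G" "x \<in> carrier G"
  shows "b \<otimes> inv x \<otimes> inv b = inv (b \<otimes> x \<otimes> inv b)"
  using assms by (simp add: m_assoc inv_mult_group)

text \<open>The library's \<open>normalizer\<close> is the stabilizer of \<open>A\<close> for
  conjugation acting on subsets of the carrier. Hence the condition is that the image equals
  \<open>A\<close>, not merely that it lies in \<open>A\<close>.\<close>

lemma mem_normalizer_iff:
  assumes "A \<subseteq> carrier G"
  shows "b \<in> normalizer G A \<longleftrightarrow> b \<in> carrier G \<and> (\<lambda>a. b \<otimes> a \<otimes> inv b) ` A = A"
proof -
  have "b <# A #> inv b = (\<lambda>a. b \<otimes> a \<otimes> inv b) ` A"
    by (auto simp: l_coset_def r_coset_def)
  then show ?thesis
    using assms by (auto simp: normalizer_def stabilizer_def)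
qed

text \<open>For a whole subgroup \<open>B\<close>, inclusion is enough: conjugating by
  \<open>inv b\<close>, also in \<open>B\<close>, supplies the reverse inclusion.\<close>

lemma subset_normalizer_iff:
  assumes "A \<subseteq> carrier G" "subgroup B G"
  shows "B \<subseteq> normalizer G A \<longleftrightarrow> (\<forall>b\<in>B. \<forall>a\<in>A. b \<otimes> a \<otimes> inv b \<in> A)"
proof
  show "B \<subseteq> normalizer G A \<Longrightarrow> \<forall>b\<in>B. \<forall>a\<in>A. b \<otimes> a \<otimes> inv b \<in> A"
    using mem_normalizer_iff[OF assms(1)] by blast
next
  assume conj: "\<forall>b\<in>B. \<forall>a\<in>A. b \<otimes> a \<otimes> inv b \<in> A"
  have "a \<in> (\<lambda>a. b \<otimes> a \<otimes> inv b) ` A" if "b \<in> B" "a \<in> A" for a b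
  proof
    have b: "b \<in> carrier G" and a: "a \<in> carrier G"
      using that assms subgroup.subset by auto
    show "a = b \<otimes> (inv b \<otimes> a \<otimes> inv (inv b)) \<otimes> inv b"
      using a b by (subst conj_conj) auto
    show "inv b \<otimes> a \<otimes> inv (inv b) \<in> A"
      using conj that subgroup.m_inv_closed[OF assms(2), of b] by simp
  qed
  moreover have "B \<subseteq> carrier G"
    by (rule subgroup.subset[OF assms(2)])
  ultimately show "B \<subseteq> normalizer G A"
    using conj mem_normalizer_iff[OF assms(1)] by blast
qed

section \<open>Binary semidirect products and the subgroups generated inside them\<close>

lemma is_semidirect_iff:
  "is_semidirect G K A B \<longleftrightarrow> subgroup A G \<and> subgroup B G \<and>
     (\<forall>b\<in>B. \<forall>a\<in>A. b \<otimes> a \<otimes> inv b \<in> A) \<and> A \<inter> B = {\<one>} \<and> K = A <#> B"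
  unfolding is_semidirect_def using subset_normalizer_iff[OF subgroup.subset] by metis

text \<open>An element of \<open>M\<close> moves past one of \<open>N\<close> at the cost of a
  conjugation, \<open>m n' = (m n' m^-1) m\<close>. This brings inverses and products back to the
  form \<open>n m\<close>.\<close>

lemma subgroup_set_mult:
  assumes N: "subgroup N G" and M: "subgroup M G"
    and conj: "\<And>m n. m \<in> M \<Longrightarrow> n \<in> N \<Longrightarrow> m \<otimes> n \<otimes> inv m \<in> N"
  shows "subgroup (N <#> M) G"
proof
  have car: "\<And>x. x \<in> N \<Longrightarrow> x \<in> carrier G" "\<And>x. x \<in> M \<Longrightarrow> x \<in> carrier G"
    using N M subgroup.mem_carrier by metis+
  show "N <#> M \<subseteq> carrier G"
    using car by (auto simp: set_mult_def)
  show "\<one> \<in> N <#> M"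
    using N M subgroup.one_closed by (force simp: set_mult_def)
  fix x assume "x \<in> N <#> M"
  then obtain n m where x: "n \<in> N" "m \<in> M" "x = n \<otimes> m"
    by (auto simp: set_mult_def)
  have "inv x = (inv m \<otimes> inv n \<otimes> inv (inv m)) \<otimes> inv m"
    using x car by (simp add: inv_mult_group m_assoc)
  then show "inv x \<in> N <#> M"
    using x conj[of "inv m" "inv n"] N M subgroup.m_inv_closed by (fastforce simp: set_mult_def)
  fix y assume "y \<in> N <#> M"
  then obtain n' m' where y: "n' \<in> N" "m' \<in> M" "y = n' \<otimes> m'"
    by (auto simp: set_mult_def)
  have "x \<otimes> y = (n \<otimes> (m \<otimes> n' \<otimes> inv m)) \<otimes> (m \<otimes> m')"
    using x y car by (simp add: m_assoc inv_solve_left)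
  moreover have "n \<otimes> (m \<otimes> n' \<otimes> inv m) \<in> N" "m \<otimes> m' \<in> M"
    using x y conj N M subgroup.m_closed by metis+
  ultimately show "x \<otimes> y \<in> N <#> M"
    by (auto simp: set_mult_def)
qed

text \<open>Conjugation by \<open>c\<close> respects products and inverses, so the hypothesis on
  generators propagates through the inductive definition of \<open>generate\<close>.\<close>

lemma generate_conj_closed:
  assumes X: "X \<subseteq> carrier G" and c: "c \<in> carrier G"
    and conj: "\<And>x. x \<in> X \<Longrightarrow> c \<otimes> x \<otimes> inv c \<in> generate G X"
    and g: "g \<in> generate G X"
  shows "c \<otimes> g \<otimes> inv c \<in> generate G X"
  using g
proof induction
  case one
  then show ?case using c generate.one by simp
next
  case (incl h)
  then show ?case by (rule conj)
next
  case (inv h)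
  then have "c \<otimes> inv h \<otimes> inv c = inv (c \<otimes> h \<otimes> inv c)"
    using X c by (auto intro: conj_inv)
  then show ?case
    using conj[OF inv] generate_m_inv_closed[OF X] by simp
next
  case (eng h1 h2)
  then have "c \<otimes> (h1 \<otimes> h2) \<otimes> inv c = (c \<otimes> h1 \<otimes> inv c) \<otimes> (c \<otimes> h2 \<otimes> inv c)"
    using X c generate_in_carrier by (intro conj_mult) auto
  then show ?case
    using eng.IH generate.eng by metis
qed

text \<open>If \<open>n m\<close> lies in \<open>A\<close>, then cancelling \<open>n\<close> puts
  \<open>m\<close> in both \<open>A\<close> and \<open>L\<close>, so \<open>m\<close> is trivial;
  the case of \<open>L\<close> is symmetric. This recovers the two factors of \<open>N <#> M\<close>
  by intersection.\<close>

lemma set_mult_inter: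
  assumes "subgroup A G" "subgroup L G" "A \<inter> L = {\<one>}"
    and "subgroup N G" "subgroup M G" "N \<subseteq> A" "M \<subseteq> L"
  shows "(N <#> M) \<inter> A = N" "(N <#> M) \<inter> L = M"
proof -
  have car: "\<And>x. x \<in> A \<Longrightarrow> x \<in> carrier G" "\<And>x. x \<in> L \<Longrightarrow> x \<in> carrier G"
    using assms subgroup.mem_carrier by metis+
  have one: "\<one> \<in> N" "\<one> \<in> M"
    using subgroup.one_closed[OF assms(4)] subgroup.one_closed[OF assms(5)] by auto
  have m: "m = \<one>" if "n \<in> N" "m \<in> M" "n \<otimes> m \<in> A" for n m
  proof -
    have "inv n \<otimes> (n \<otimes> m) \<in> A"
      using that assms(6) by (auto intro!: subgroup.m_closed[OF assms(1)] subgroup.m_inv_closed[OF assms(1)])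
    moreover have "inv n \<otimes> (n \<otimes> m) = m"
      using that assms(6,7) car inv_solve_left'[of m n "n \<otimes> m"] by blast
    ultimately show ?thesis using that assms by auto
  qed
  have n: "n = \<one>" if "n \<in> N" "m \<in> M" "n \<otimes> m \<in> L" for n m
  proof -
    have "(n \<otimes> m) \<otimes> inv m \<in> L"
      using that assms(7) by (auto intro!: subgroup.m_closed[OF assms(2)] subgroup.m_inv_closed[OF assms(2)])
    moreover have "(n \<otimes> m) \<otimes> inv m = n"
      using that assms(6,7) car inv_solve_right'[of n "n \<otimes> m" m] by blast
    ultimately show ?thesis using that assms by auto
  qed
  have "x \<in> N" if x: "x \<in> N <#> M" "x \<in> A" for x
  proof -
    obtain n' m' where "n' \<in> N" "m' \<in> M" "x = n' \<otimes> m'"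
      using x by (auto simp: set_mult_def)
    then show ?thesis using m[of n' m'] x car assms(6) by auto
  qed
  moreover have "x \<in> M" if x: "x \<in> N <#> M" "x \<in> L" for x
  proof -
    obtain n' m' where "n' \<in> N" "m' \<in> M" "x = n' \<otimes> m'"
      using x by (auto simp: set_mult_def)
    then show ?thesis using n[of n' m'] x car assms(7) by auto
  qed
  moreover have "x \<in> N <#> M" if "x \<in> N" for x
  proof -
    have "x = x \<otimes> \<one>" using that car assms(6) by auto
    then show ?thesis using that one unfolding set_mult_def by blast
  qed
  moreover have "x \<in> N <#> M" if "x \<in> M" for x
  proof -
    have "x = \<one> \<otimes> x" using that car assms(7) by auto
    then show ?thesis using that one unfolding set_mult_def by blast
  qed
  ultimately show "(N <#> M) \<inter> A = N" "(N <#> M) \<inter> L = M"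
    using assms(6,7) by blast+
qed

lemma generate_semidirect:
  assumes K: "is_semidirect G K A L" and T: "T \<subseteq> A \<union> L"
  shows "generate G T \<inter> L = generate G (T \<inter> L)"
    and "generate G T \<inter> A
      = generate G {b \<otimes> a \<otimes> inv b | a b. a \<in> T \<inter> A \<and> b \<in> generate G (T \<inter> L)}"
    and "is_semidirect G (generate G T) (generate G T \<inter> A) (generate G T \<inter> L)"
proof -
  define M where "M = generate G (T \<inter> L)"
  define X where "X = {b \<otimes> a \<otimes> inv b | a b. a \<in> T \<inter> A \<and> b \<in> M}"
  define N where "N = generate G X"
  have A: "subgroup A G" and L: "subgroup L G" and triv: "A \<inter> L = {\<one>}"
    and norm: "\<And>b a. b \<in> L \<Longrightarrow> a \<in> A \<Longrightarrow> b \<otimes> a \<otimes> inv b \<in> A"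
    using K by (auto simp: is_semidirect_iff)
  have car: "\<And>x. x \<in> A \<Longrightarrow> x \<in> carrier G" "\<And>x. x \<in> L \<Longrightarrow> x \<in> carrier G"
    using A L subgroup.mem_carrier by metis+
  have Tcar: "T \<subseteq> carrier G"
    using T car by auto
  have H: "subgroup (generate G T) G"
    by (rule generate_is_subgroup[OF Tcar])
  have M: "subgroup M G"
    unfolding M_def using car by (intro generate_is_subgroup) auto
  have M_sub_L: "M \<subseteq> L"
    unfolding M_def by (rule generate_subgroup_incl[OF _ L]) auto
  have MH: "M \<subseteq> generate G T"
    unfolding M_def by (rule mono_generate) auto
  have XA: "X \<subseteq> A"
    unfolding X_def using M_sub_L norm by auto
  then have Xcar: "X \<subseteq> carrier G"
    using car by auto
  then have N: "subgroup N G"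
    unfolding N_def by (rule generate_is_subgroup)
  have NA: "N \<subseteq> A"
    unfolding N_def by (rule generate_subgroup_incl[OF XA A])
  have "X \<subseteq> generate G T"
    unfolding X_def using MH generate.incl[of _ T G] H
    by (auto intro!: subgroup.m_closed[OF H] subgroup.m_inv_closed[OF H])
  then have NH: "N \<subseteq> generate G T"
    unfolding N_def by (rule generate_subgroup_incl[OF _ H])
  \<comment> \<open>The generating set itself is stable under \<open>M\<close>, because conjugating
    by \<open>b\<close> and then by \<open>c\<close> is conjugating by \<open>c \<otimes> b\<close>,
    again in \<open>M\<close>. Stability of \<open>N\<close> follows from that of its
    generators.\<close>
  have conjX: "c \<otimes> x \<otimes> inv c \<in> X" if "c \<in> M" "x \<in> X" for c x
  proof -
    obtain a b where ab: "a \<in> T \<inter> A" "b \<in> M" "x = b \<otimes> a \<otimes> inv b"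
      using \<open>x \<in> X\<close> by (auto simp: X_def)
    have "c \<otimes> x \<otimes> inv c = (c \<otimes> b) \<otimes> a \<otimes> inv (c \<otimes> b)"
      unfolding ab using ab \<open>c \<in> M\<close> M_sub_L car by (intro conj_conj) auto
    then show ?thesis
      using ab subgroup.m_closed[OF M \<open>c \<in> M\<close> \<open>b \<in> M\<close>] by (auto simp: X_def)
  qed
  have conjN: "c \<otimes> x \<otimes> inv c \<in> N" if "c \<in> M" "x \<in> N" for c x
    using generate_conj_closed[OF Xcar, of c x] that conjX[OF \<open>c \<in> M\<close>] generate.incl[of _ X G] M_sub_L car
    by (auto simp: N_def)
  have NM: "subgroup (N <#> M) G"
    by (rule subgroup_set_mult[OF N M conjN])
  have one: "\<one> \<in> N" "\<one> \<in> M"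
    using N M subgroup.one_closed by auto
  have "T \<subseteq> N <#> M"
  proof
    fix x assume x: "x \<in> T"
    then consider "x \<in> A" | "x \<in> L" using T by auto
    then show "x \<in> N <#> M"
    proof cases
      case 1
      \<comment> \<open>An element of \<open>T\<close> in \<open>A\<close> is its own conjugate by
        the identity of \<open>M\<close>, hence a generator of \<open>N\<close>.\<close>
      have "\<one> \<otimes> x \<otimes> inv \<one> = x" using 1 car by simp
      then have "x \<in> X" unfolding X_def using x 1 one by force
      then have "x \<in> N" unfolding N_def by (rule generate.incl)
      then show ?thesis using one car 1 by (force simp: set_mult_def)
    next
      case 2
      then have "x \<in> M" unfolding M_def using x by (auto intro: generate.incl)
      then show ?thesis using one car 2 by (force simp: set_mult_def)
    qed
  qed
  then have "generate G T \<subseteq> N <#> M"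
    by (rule generate_subgroup_incl[OF _ NM])
  moreover have "N <#> M \<subseteq> generate G T"
    using NH MH subgroup.m_closed[OF H] by (auto simp: set_mult_def)
  ultimately have HNM: "generate G T = N <#> M" by blast
  have HA: "generate G T \<inter> A = N" and HL: "generate G T \<inter> L = M"
    unfolding HNM using set_mult_inter[OF A L triv N M NA M_sub_L] by auto
  show "generate G T \<inter> L = generate G (T \<inter> L)"
    using HL by (simp add: M_def)
  show "generate G T \<inter> A
      = generate G {b \<otimes> a \<otimes> inv b | a b. a \<in> T \<inter> A \<and> b \<in> generate G (T \<inter> L)}"
    using HA by (simp add: N_def X_def M_def)
  have "N \<inter> M = {\<one>}"
    using NA M_sub_L triv one by blast
  then show "is_semidirect G (generate G T) (generate G T \<inter> A) (generate G T \<inter> L)"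
    unfolding HA HL is_semidirect_iff using N M conjN HNM by auto
qed

end

section \<open>Descending products and k-ary decompositions\<close>

lemma desc_prod_cong:
  "(\<And>i. i \<in> {1..n} \<Longrightarrow> a i = b i) \<Longrightarrow> desc_prod G a n = desc_prod G b n"
  by (induction n) auto

lemma product_set_0: "product_set G A 0 = {\<one>\<^bsub>G\<^esub>}"
  by (auto simp: product_set_def)

lemma product_set_Suc:
  "product_set G A (Suc n) = A (Suc n) <#>\<^bsub>G\<^esub> product_set G A n"
proof
  show "product_set G A (Suc n) \<subseteq> A (Suc n) <#>\<^bsub>G\<^esub> product_set G A n"
    by (fastforce simp: product_set_def set_mult_def)
  show "A (Suc n) <#>\<^bsub>G\<^esub> product_set G A n \<subseteq> product_set G A (Suc n)"
  proof
    fix x assume "x \<in> A (Suc n) <#>\<^bsub>G\<^esub> product_set G A n"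
    then obtain y a where "y \<in> A (Suc n)" "\<forall>i\<in>{1..n}. a i \<in> A i"
      "x = y \<otimes>\<^bsub>G\<^esub> desc_prod G a n"
      by (auto simp: product_set_def set_mult_def)
    \<comment> \<open>The top entry of \<open>a\<close> is unconstrained, so it may be overwritten
      by \<open>y\<close> without affecting the product of the lower entries.\<close>
    moreover have "desc_prod G a n = desc_prod G (a(Suc n := y)) n"
      by (rule desc_prod_cong) auto
    ultimately show "x \<in> product_set G A (Suc n)"
      by (auto simp: product_set_def intro!: exI[of _ "a(Suc n := y)"])
  qed
qed

lemma product_set_cong:
  "(\<And>i. i \<in> {1..n} \<Longrightarrow> A i = B i) \<Longrightarrow> product_set G A n = product_set G B n"
  by (induction n) (auto simp: product_set_0 product_set_Suc)

text \<open>The defining recursion matches on two successors because its base case is one factor;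
  this form allows ordinary one-step induction.\<close>

lemma semidirect_decomp_Suc:
  "n \<ge> 1 \<Longrightarrow> semidirect_decomp G K A (Suc n) \<longleftrightarrow>
     (\<exists>L. semidirect_decomp G L A n \<and> is_semidirect G K (A (Suc n)) L)"
  by (cases n) auto

lemma semidirect_decomp_cong:
  assumes "\<And>i. i \<in> {1..n} \<Longrightarrow> A i = B i"
  shows "semidirect_decomp G K A n = semidirect_decomp G K B n"
  using assms
proof (induction n arbitrary: K)
  case (Suc n)
  have "A (Suc n) = B (Suc n)"
    using Suc.prems by simp
  moreover have "semidirect_decomp G L A n = semidirect_decomp G L B n" for L
    using Suc.prems by (intro Suc.IH) simp
  ultimately show ?case
    by (cases "n = 0") (simp_all add: semidirect_decomp_Suc)
qed simp

context group
begin

lemma semidirect_decomp_induct [consumes 1, case_names one Suc]: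
  assumes "semidirect_decomp G K A n"
    and "subgroup (A 1) G \<Longrightarrow> P (A 1) 1"
    and "\<And>n K L. n \<ge> 1 \<Longrightarrow> semidirect_decomp G L A n \<Longrightarrow> is_semidirect G K (A (Suc n)) L
      \<Longrightarrow> P L n \<Longrightarrow> P K (Suc n)"
  shows "P K n"
  using assms(1)
proof (induction n arbitrary: K)
  case (Suc n)
  then show ?case
    using assms(2,3) by (cases "n = 0") (auto simp: semidirect_decomp_Suc)
qed simp

lemma semidirect_decomp_factor_subgroup:
  assumes "semidirect_decomp G K A n" "j \<in> {1..n}"
  shows "subgroup (A j) G"
  using assms
proof (induction rule: semidirect_decomp_induct)
  case (Suc n K L)
  then show ?case
    by (cases "j = Suc n") (auto simp: is_semidirect_iff)
qed simp

text \<open>The factors thus determine \<open>K\<close>. In particular the subgroup \<open>L\<close>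
  hidden by the existential in the recursion is the product set of the lower factors.\<close>

lemma semidirect_decomp_product_set:
  assumes "semidirect_decomp G K A n"
  shows "K = product_set G A n"
  using assms
proof (induction rule: semidirect_decomp_induct)
  case one
  then show ?case
    using subgroup.mem_carrier by (force simp: product_set_Suc product_set_0 set_mult_def)
next
  case (Suc n K L)
  then show ?case by (simp add: product_set_Suc is_semidirect_iff)
qed

lemma desc_prod_single:
  assumes "x \<in> carrier G" "j \<ge> 1"
  shows "desc_prod G (\<lambda>i. if i = j then x else \<one>) n = (if j \<le> n then x else \<one>)"
  using assms by (induction n) auto

lemma semidirect_decomp_factor_subset:
  assumes K: "semidirect_decomp G K A n" and j: "j \<in> {1..n}"
  shows "A j \<subseteq> K"
proof
  fix x assume x: "x \<in> A j"
  \<comment> \<open>An element of one factor is a full product whose other entries are all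
    trivial.\<close>
  have "desc_prod G (\<lambda>i. if i = j then x else \<one>) n = x"
    using desc_prod_single[of x j n] x j
      subgroup.mem_carrier[OF semidirect_decomp_factor_subgroup[OF K j]] by auto
  moreover have "\<forall>i\<in>{1..n}. (if i = j then x else \<one>) \<in> A i"
    using x subgroup.one_closed[OF semidirect_decomp_factor_subgroup[OF K]] by auto
  ultimately have "x \<in> product_set G A n"
    unfolding product_set_def by (auto intro!: exI[of _ "\<lambda>i. if i = j then x else \<one>"])
  then show "x \<in> K"
    using semidirect_decomp_product_set[OF K] by simp
qed

section \<open>Uniqueness of factorisations and the component maps\<close>

lemma semidirect_factors_unique:
  assumes "is_semidirect G K A L" "a \<in> A" "b \<in> A" "l \<in> L" "m \<in> L" "a \<otimes> l = b \<otimes> m"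
  shows "a = b" "l = m"
proof -
  have A: "subgroup A G" and L: "subgroup L G" and triv: "A \<inter> L = {\<one>}"
    using assms by (auto simp: is_semidirect_iff)
  have car: "a \<in> carrier G" "b \<in> carrier G" "l \<in> carrier G" "m \<in> carrier G"
    using assms A L subgroup.mem_carrier by metis+
  \<comment> \<open>Rearranging \<open>a \<otimes> l = b \<otimes> m\<close> separates the factors:
    the left side below lies in \<open>A\<close>, the final right side in \<open>L\<close>, so both
    are trivial.\<close>
  have "inv b \<otimes> a = inv b \<otimes> (a \<otimes> l) \<otimes> inv l"
    using car by (simp add: m_assoc)
  also have "\<dots> = m \<otimes> inv l"
    unfolding assms(6) using car by (simp add: m_assoc[symmetric])
  finally have eq: "inv b \<otimes> a = m \<otimes> inv l" .
  moreover have "inv b \<otimes> a \<in> A"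
    using assms by (intro subgroup.m_closed[OF A] subgroup.m_inv_closed[OF A])
  moreover have "m \<otimes> inv l \<in> L"
    using assms by (intro subgroup.m_closed[OF L] subgroup.m_inv_closed[OF L])
  ultimately have "inv b \<otimes> a = \<one>" "m \<otimes> inv l = \<one>"
    using triv by auto
  then show "a = b" "l = m"
    using car inv_solve_left'[of \<one> b a] inv_solve_right'[of \<one> m l] by auto
qed

text \<open>The top entry lies in \<open>A (Suc n)\<close> and the remaining product in
  \<open>L\<close>, so binary uniqueness splits off the top entry and leaves equal shorter products
  for the induction.\<close>

lemma desc_prod_inj:
  assumes "semidirect_decomp G K A n"
    and "\<And>i. i \<in> {1..n} \<Longrightarrow> a i \<in> A i" "\<And>i. i \<in> {1..n} \<Longrightarrow> b i \<in> A i"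
    and "desc_prod G a n = desc_prod G b n" "j \<in> {1..n}"
  shows "a j = b j"
  using assms
proof (induction rule: semidirect_decomp_induct)
  case one
  then show ?case using subgroup.mem_carrier by force
next
  case (Suc n K L)
  have "desc_prod G c n \<in> L" if "\<And>i. i \<in> {1..Suc n} \<Longrightarrow> c i \<in> A i" for c
    using that semidirect_decomp_product_set[OF Suc.hyps(2)] by (auto simp: product_set_def)
  then have "a (Suc n) = b (Suc n) \<and> desc_prod G a n = desc_prod G b n"
    using semidirect_factors_unique[OF Suc.hyps(3), of "a (Suc n)" "b (Suc n)"
        "desc_prod G a n" "desc_prod G b n"] Suc.prems by auto
  then show ?case
    using Suc.IH Suc.prems by (auto simp: le_Suc_eq)
qed

lemma component_desc_prod:
  assumes K: "semidirect_decomp G K A n"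
    and a: "\<And>i. i \<in> {1..n} \<Longrightarrow> a i \<in> A i" and j: "j \<in> {1..n}"
  shows "component G A n j (desc_prod G a n) = a j"
proof -
  \<comment> \<open>\<open>component\<close> selects its tuple from the extensional function space,
    so the witness has to be \<open>undefined\<close> outside \<open>{1..n}\<close>.\<close>
  define a' where "a' = restrict a {1..n}"
  have "desc_prod G a' n = desc_prod G a n"
    by (rule desc_prod_cong) (auto simp: a'_def)
  then have "(THE b. b \<in> (\<Pi>\<^sub>E i\<in>{1..n}. A i) \<and> desc_prod G a n = desc_prod G b n) = a'"
  proof (intro the_equality)
    fix b assume b: "b \<in> (\<Pi>\<^sub>E i\<in>{1..n}. A i) \<and> desc_prod G a n = desc_prod G b n"
    show "b = a'"
    proof
      fix i show "b i = a' i"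
      proof (cases "i \<in> {1..n}")
        case True
        have "b i' \<in> A i'" if "i' \<in> {1..n}" for i'
          using b that by (blast dest: PiE_mem)
        then have "a i = b i"
          using desc_prod_inj[OF K a _ _ True] b by blast
        then show ?thesis
          unfolding a'_def using True by simp
      next
        case False
        then show ?thesis
          using b unfolding a'_def by (metis PiE_arb restrict_apply)
      qed
    qed
  qed (use a in \<open>auto simp: a'_def\<close>)
  then show ?thesis
    using j by (simp add: component_def a'_def)
qed

section \<open>Generated subgroups in the k-ary case\<close>

lemma augmented_gens_1:
  assumes "S \<inter> A 1 \<subseteq> carrier G"
  shows "augmented_gens G A S 1 = S \<inter> A 1"
  using assms by (force simp: augmented_gens_def product_set_0 subset_eq)

text \<open>\<open>S\<close> varies in the induction, since the hypothesis is applied to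
  \<open>S \<inter> L\<close>. Both claims are proved together: the generators at the top index are
  identified by means of the decomposition of the lower part.\<close>

lemma semidirect_decomp_generate:
  assumes "semidirect_decomp G K A n" "S \<subseteq> (\<Union>j\<in>{1..n}. A j)"
  shows "semidirect_decomp G (generate G S) (trace G A S) n \<and>
    (\<forall>j\<in>{1..n}. generate G S \<inter> A j = generate G (augmented_gens G A S j))"
  using assms
proof (induction arbitrary: S rule: semidirect_decomp_induct)
  case one
  then have S: "S \<subseteq> A 1" by simp
  then have "generate G S \<subseteq> A 1"
    by (rule generate_subgroup_incl[OF _ one(1)])
  then have "generate G S \<inter> A 1 = generate G S" by blast
  moreover have Scar: "S \<subseteq> carrier G"
    using S subgroup.subset[OF one(1)] by blast
  then have "augmented_gens G A S 1 = S"
    using S augmented_gens_1[of S A] by blast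
  ultimately show ?case
    using generate_is_subgroup[OF Scar] by (simp add: trace_def)
next
  case (Suc n K L)
  define S' where "S' = S \<inter> L"
  have sub: "A j \<subseteq> L" if "j \<in> {1..n}" for j
    by (rule semidirect_decomp_factor_subset[OF Suc.hyps(2) that])
  have "S \<subseteq> (\<Union>j\<in>{1..n}. A j) \<union> A (Suc n)"
    using Suc.prems by (force simp: le_Suc_eq)
  moreover from this have SAL: "S \<subseteq> A (Suc n) \<union> L"
    using sub by blast
  moreover have "A (Suc n) \<inter> L = {\<one>}"
    using Suc.hyps(3) by (simp add: is_semidirect_iff)
  moreover have "\<one> \<in> A 1"
    using subgroup.one_closed[OF semidirect_decomp_factor_subgroup[OF Suc.hyps(2), of 1]] Suc.hyps(1)
    by simp
  moreover have "1 \<in> {1..n}"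
    using Suc.hyps(1) by simp
  \<comment> \<open>An element of \<open>S \<inter> L\<close> coming from the top factor lies in
    \<open>A (Suc n) \<inter> L\<close>, so it is the identity, which is covered by
    \<open>A 1\<close>.\<close>
  ultimately have S': "S' \<subseteq> (\<Union>j\<in>{1..n}. A j)"
    unfolding S'_def by blast
  have gen: "generate G S \<inter> L = generate G S'"
    and gen_A: "generate G S \<inter> A (Suc n)
      = generate G {b \<otimes> a \<otimes> inv b | a b. a \<in> S \<inter> A (Suc n) \<and> b \<in> generate G S'}"
    and semi: "is_semidirect G (generate G S) (generate G S \<inter> A (Suc n)) (generate G S \<inter> L)"
    using generate_semidirect[OF Suc.hyps(3) SAL] by (simp_all add: S'_def)
  \<comment> \<open>Since \<open>A j\<close> lies in \<open>L\<close>, intersecting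
    \<open>generate G S\<close> with \<open>A j\<close> may pass through
    \<open>generate G S \<inter> L\<close>, which is \<open>generate G S'\<close>.\<close>
  have tr: "trace G A S' j = trace G A S j" if "j \<in> {1..n}" for j
    using sub[OF that] gen by (auto simp: trace_def)
  have dec: "semidirect_decomp G (generate G S') (trace G A S) n"
    using Suc.IH[OF S'] semidirect_decomp_cong[of n "trace G A S'", OF tr] by blast
  have "semidirect_decomp G (generate G S) (trace G A S) (Suc n)"
    using dec semi gen Suc.hyps(1) by (auto simp: semidirect_decomp_Suc trace_def)
  moreover have "generate G S \<inter> A j = generate G (augmented_gens G A S j)"
    if j: "j \<in> {1..Suc n}" for j
  proof (cases "j = Suc n")
    case True
    \<comment> \<open>The binary lemma conjugates by all of \<open>generate G S'\<close>. By
      \<open>dec\<close> this is the product set of the traces up to \<open>n\<close>, which is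
      \<open>j - 1\<close> here.\<close>
    then show ?thesis
      using gen_A semidirect_decomp_product_set[OF dec] by (simp add: augmented_gens_def)
  next
    case False
    then have j: "j \<in> {1..n}" using j by auto
    have "product_set G (trace G A S') (j - 1) = product_set G (trace G A S) (j - 1)"
      using j by (intro product_set_cong tr) auto
    moreover have "S' \<inter> A j = S \<inter> A j"
      using sub[OF j] by (auto simp: S'_def)
    ultimately have "augmented_gens G A S' j = augmented_gens G A S j"
      by (simp add: augmented_gens_def)
    then show ?thesis
      using Suc.IH[OF S'] tr[OF j] j by (simp add: trace_def)
  qed
  ultimately show ?case by blast
qed

text \<open>As each \<open>B i\<close> lies in \<open>A i\<close>, a factorisation over
  \<open>B\<close> is also the unique one over \<open>A\<close>, so the components of elements of
  \<open>H\<close> lie in the smaller factors.\<close>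

lemma component_image:
  assumes K: "semidirect_decomp G K A n" and H: "semidirect_decomp G H B n"
    and BA: "\<And>i. i \<in> {1..n} \<Longrightarrow> B i \<subseteq> A i" and j: "j \<in> {1..n}"
  shows "component G A n j ` H = B j"
proof
  have comp: "component G A n j (desc_prod G b n) = b j" if "\<forall>i\<in>{1..n}. b i \<in> B i" for b
    using that BA by (intro component_desc_prod[OF K _ j]) blast
  then show "component G A n j ` H \<subseteq> B j"
    using semidirect_decomp_product_set[OF H] j by (auto simp: product_set_def)
  show "B j \<subseteq> component G A n j ` H"
  proof
    fix x assume x: "x \<in> B j"
    \<comment> \<open>For surjectivity, \<open>x\<close> is the component of the product with
      \<open>x\<close> at place \<open>j\<close> and the identity elsewhere.\<close>
    define b where "b = (\<lambda>i. if i = j then x else \<one>)"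
    have b: "\<forall>i\<in>{1..n}. b i \<in> B i"
      using x subgroup.one_closed[OF semidirect_decomp_factor_subgroup[OF H]] by (auto simp: b_def)
    then have "desc_prod G b n \<in> H"
      using semidirect_decomp_product_set[OF H] by (auto simp: product_set_def)
    moreover have "component G A n j (desc_prod G b n) = x"
      using comp[OF b] by (simp add: b_def)
    ultimately show "x \<in> component G A n j ` H" by force
  qed
qed

end

theorem theorem5p7:
  fixes G :: "('a, 'b) monoid_scheme"
    and A :: "nat \<Rightarrow> 'a set" and S :: "'a set" and k :: nat
  assumes "group G"
    and "k \<ge> 1"
    and "semidirect_decomp G (carrier G) A k"
    and "S \<subseteq> (\<Union>j\<in>{1..k}. A j)"
  shows "semidirect_decomp G (generate G S) (trace G A S) k
    \<and> (\<forall>j\<in>{1..k}.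
          trace G A S j = generate G S \<inter> A j
        \<and> generate G S \<inter> A j = generate G (augmented_gens G A S j)
        \<and> generate G (augmented_gens G A S j) = component G A k j ` generate G S)
    \<and> augmented_gens G A S 1 = S \<inter> A 1"
proof -
  interpret group G by fact
  have dec: "semidirect_decomp G (generate G S) (trace G A S) k"
    and gens: "\<And>j. j \<in> {1..k} \<Longrightarrow> generate G S \<inter> A j = generate G (augmented_gens G A S j)"
    using semidirect_decomp_generate[OF assms(3,4)] by auto
  \<comment> \<open>The traces serve as the smaller factors; each is an intersection with
    \<open>A j\<close>, hence contained in it.\<close>
  have comp: "component G A k j ` generate G S = generate G S \<inter> A j" if "j \<in> {1..k}" for j
    using component_image[OF assms(3) dec _ that] by (simp add: trace_def)
  have "A 1 \<subseteq> carrier G"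
    using semidirect_decomp_factor_subset[OF assms(3), of 1] assms(2) by simp
  then have "augmented_gens G A S 1 = S \<inter> A 1"
    by (intro augmented_gens_1) auto
  then show ?thesis
    using dec gens comp by (auto simp: trace_def)
qed

end
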